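(* $\rho(\omega\cdot K_3)\geq 1-\frac{1}{\sqrt{7}}$, and consequently $f(2)\geq 1-\frac{1}{\sqrt{7}}$.
   Context: Let $K_\mathbb{N}$ be the complete graph on the natural numbers. For $S\subseteq\mathbb{N}$, $\bar d(S)=\limsup_{t\to\infty}\frac{|S\cap[t]|}{t}$; for a subgraph $G\subseteq K_\mathbb{N}$, $\bar d(G)=\bar d(V(G))$. For a countably infinite graph $H$, $\rho(H)$ is the supremum of all $\lambda$ such that in every red-blue coloring of the edges of $K_\mathbb{N}$ there is a monochromatic subgraph $H'\subseteq K_\mathbb{N}$ isomorphic to $H$ with $\bar d(H')\geq\lambda$. $\omega\cdot K_3$ is the graph consisting of infinitely many pairwise vertex-disjoint triangles. The function $f$: for a continuous $g:[0,\infty)\to\mathbb{R}$ and $\gamma,t\in\mathbb{R}$ let $\Gamma^+_\gamma(g,t)=\min\{x\ge0:\gamma x+g(x)\geq t\}$ and $\Gamma^-_\gamma(g,t)=\min\{x\ge0:\gamma x-g(x)\geq t\}$ (minimum of the empty set is $+\infty$). Let $h(\gamma)$ be the infimum, over all 1-Lipschitz $g$ with $g(0)=0$, of $\limsup_{t\to\infty}\frac{\Gamma^+_\gamma(g,t)+\Gamma^-_\gamma(g,t)}{t}$. For $\lambda\in(0,\infty)$, \[f(\lambda)=1-\frac{1}{\frac{2\lambda}{(1+\lambda)^2}h\left(\frac{\lambda-1}{\lambda+1}\right)+\frac{2\lambda}{1+\lambda}}.\] *)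

theory Defs
  imports "HOL-Analysis.Analysis"
begin

record 'a graph =
  verts :: "'a set"
  edges :: "'a set set"

definition simple_graph :: "'a graph \<Rightarrow> bool" where
  "simple_graph G \<longleftrightarrow> (\<forall>e\<in>edges G. e \<subseteq> verts G \<and> card e = 2)"

definition complete_graph :: "'a set \<Rightarrow> 'a graph" where
  "complete_graph V = \<lparr>verts = V, edges = {e. e \<subseteq> V \<and> card e = 2}\<rparr>"

definition subgraph :: "'a graph \<Rightarrow> 'a graph \<Rightarrow> bool" where
  "subgraph G H \<longleftrightarrow> simple_graph G \<and> verts G \<subseteq> verts H \<and> edges G \<subseteq> edges H"

definition graph_iso :: "'a graph \<Rightarrow> 'b graph \<Rightarrow> bool" where
  "graph_iso G H \<longleftrightarrow>
     (\<exists>\<phi>. bij_betw \<phi> (verts G) (verts H) \<and>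
          (\<forall>u\<in>verts G. \<forall>v\<in>verts G. {u, v} \<in> edges G \<longleftrightarrow> {\<phi> u, \<phi> v} \<in> edges H))"

definition omega_copies :: "'a graph \<Rightarrow> (nat \<times> 'a) graph" where
  "omega_copies G =
     \<lparr>verts = UNIV \<times> verts G, edges = {Pair i ` e | i e. e \<in> edges G}\<rparr>"

abbreviation K_nat :: "nat graph" where
  "K_nat \<equiv> complete_graph UNIV"

abbreviation K3 :: "nat graph" where
  "K3 \<equiv> complete_graph {0, 1, 2}"

definition upper_density :: "nat set \<Rightarrow> ereal" where
  "upper_density S = limsup (\<lambda>t. ereal (real (card (S \<inter> {1..t})) / real t))"

datatype colour = Red | Blue

text \<open>An edge colouring of \<^term>\<open>K_nat\<close> is a total function on sets of vertices;
  only its values on edges are ever used.\<close>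

definition monochromatic :: "('a set \<Rightarrow> colour) \<Rightarrow> 'a graph \<Rightarrow> bool" where
  "monochromatic c G \<longleftrightarrow> (\<exists>col. \<forall>e\<in>edges G. c e = col)"

definition ramsey_density :: "'a graph \<Rightarrow> ereal" where
  "ramsey_density H = Sup (ereal ` {l :: real. \<forall>c :: nat set \<Rightarrow> colour.
     \<exists>H'. subgraph H' K_nat \<and> monochromatic c H' \<and> graph_iso H H' \<and>
          upper_density (verts H') \<ge> ereal l})"

text \<open>For \<^term>\<open>g\<close> continuous on \<open>[0,\<infinity>)\<close> the sets below are closed, so the minimum exists
  whenever they are nonempty. Values of \<^term>\<open>g\<close> at negative arguments play no role.\<close>

definition Gamma_plus :: "real \<Rightarrow> (real \<Rightarrow> real) \<Rightarrow> real \<Rightarrow> ereal" where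
  "Gamma_plus \<gamma> g t =
     (if \<exists>x\<ge>0. \<gamma> * x + g x \<ge> t
      then ereal (LEAST x. x \<ge> 0 \<and> \<gamma> * x + g x \<ge> t) else \<infinity>)"

definition Gamma_minus :: "real \<Rightarrow> (real \<Rightarrow> real) \<Rightarrow> real \<Rightarrow> ereal" where
  "Gamma_minus \<gamma> g t =
     (if \<exists>x\<ge>0. \<gamma> * x - g x \<ge> t
      then ereal (LEAST x. x \<ge> 0 \<and> \<gamma> * x - g x \<ge> t) else \<infinity>)"

definition h_inf :: "real \<Rightarrow> ereal" where
  "h_inf \<gamma> = (INF g \<in> {g :: real \<Rightarrow> real. 1-lipschitz_on {0..} g \<and> g 0 = 0}.
     Limsup at_top (\<lambda>t :: real. (Gamma_plus \<gamma> g t + Gamma_minus \<gamma> g t) / ereal t))"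

text \<open>Only meant for \<open>l > 0\<close>; extended-real valued because \<^const>\<open>h_inf\<close> is,
  with \<open>1 / \<infinity> = 0\<close>.\<close>

definition f_dens :: "real \<Rightarrow> ereal" where
  "f_dens l = 1 - 1 / (ereal (2 * l / (1 + l)\<^sup>2) * h_inf ((l - 1) / (l + 1))
                        + ereal (2 * l / (1 + l)))"

end

theory Submission
  imports Defs "HOL-Library.Ramsey"
begin

text \<open>By Ramsey's theorem all but finitely many vertices lie in an infinite red clique or in an
  infinite blue clique. Let \<open>X\<close> be the former and \<open>Y\<close> the remaining vertices. Finite parts of \<open>X\<close>
  are covered by disjoint red triangles, finite parts of \<open>Y\<close> by blue ones, with the other two
  vertices chosen arbitrarily far out; this already gives density 1/2. To gain more, take \<open>N\<close> with
  \<open>|X \<inter> [N]| \<ge> |Y \<inter> [N]|\<close> (up to swapping colours) and \<open>t = 7N/10\<close>. Blue triangles with one vertex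
  in \<open>X \<inter> [t]\<close> and two in \<open>Y \<inter> [N]\<close> add vertices of \<open>X\<close> to the blue tiling of \<open>[t]\<close>. Once no further
  such triangle exists, almost all remaining pairs between \<open>X \<inter> [t]\<close> and \<open>Y \<inter> [N]\<close> are red, and
  red triangles with two vertices in \<open>X\<close> add vertices of \<open>Y\<close> to the red tiling of \<open>[N]\<close>. Counting
  shows that one of the two tilings has density at least \<open>5/8 > 1 - 1/\<surd>7\<close>. Good finite tilings for
  arbitrarily large \<open>t\<close> are then glued along a rapidly growing sequence of scales.

  For \<open>f\<close> it suffices that \<open>h(1/3) \<ge> 3\<close>. If the two hitting times \<open>x(t)\<close>, \<open>y(t)\<close> always have sum
  below \<open>3t\<close>, the Lipschitz condition forces the smaller below \<open>t\<close> and the larger above \<open>15t/8\<close>.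
  If \<open>y(t)\<close> is the larger, put \<open>u = y(t)\<close>; as \<open>y\<close> is monotone, \<open>y(u) \<ge> u\<close>, so
  \<open>x(u) < u\<close>, and then \<open>g\<close> would have to fall too fast between \<open>x(u)\<close> and \<open>u\<close>.\<close>

section \<open>Monochromatic triangle tilings\<close>

definition mono_clique :: "('a set \<Rightarrow> colour) \<Rightarrow> colour \<Rightarrow> 'a set \<Rightarrow> bool" where
  "mono_clique c col Q \<longleftrightarrow> (\<forall>x\<in>Q. \<forall>y\<in>Q. x \<noteq> y \<longrightarrow> c {x, y} = col)"

definition mono_triangle :: "('a set \<Rightarrow> colour) \<Rightarrow> colour \<Rightarrow> 'a set \<Rightarrow> bool" where
  "mono_triangle c col T \<longleftrightarrow> card T = 3 \<and> mono_clique c col T"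

definition tiling :: "('a set \<Rightarrow> colour) \<Rightarrow> colour \<Rightarrow> 'a set set \<Rightarrow> bool" where
  "tiling c col F \<longleftrightarrow> disjoint F \<and> (\<forall>T\<in>F. mono_triangle c col T)"

text \<open>The tiles may leave \<open>S\<close>: the density only counts vertices below a given
  scale, and their partners may lie arbitrarily far out.\<close>

definition coverable :: "('a set \<Rightarrow> colour) \<Rightarrow> colour \<Rightarrow> 'a set \<Rightarrow> bool" where
  "coverable c col S \<longleftrightarrow> (\<exists>F. finite F \<and> tiling c col F \<and> S \<subseteq> \<Union>F)"

lemma mono_clique_subset: "mono_clique c col Q \<Longrightarrow> P \<subseteq> Q \<Longrightarrow> mono_clique c col P"
  unfolding mono_clique_def by blast

lemma mono_triangle_insert3:
  assumes "x \<noteq> y" "x \<noteq> z" "y \<noteq> z" "c {x, y} = col" "c {x, z} = col" "c {y, z} = col"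
  shows "mono_triangle c col {x, y, z}"
  using assms unfolding mono_triangle_def mono_clique_def by (auto simp: insert_commute)

lemma mono_triangle_finite: "mono_triangle c col T \<Longrightarrow> finite T"
  unfolding mono_triangle_def by (metis card.infinite zero_neq_numeral)

lemma disjoint_insert_set:
  "disjoint F \<Longrightarrow> (\<And>U. U \<in> F \<Longrightarrow> T \<inter> U = {}) \<Longrightarrow> disjoint (insert T F)"
  unfolding disjoint_def by blast

lemma tiling_insert:
  "tiling c col F \<Longrightarrow> mono_triangle c col T \<Longrightarrow> T \<inter> \<Union>F = {} \<Longrightarrow> tiling c col (insert T F)"
  unfolding tiling_def by (auto intro!: disjoint_insert_set)

lemma tiling_Un:
  "tiling c col F \<Longrightarrow> tiling c col G \<Longrightarrow> \<Union>F \<inter> \<Union>G = {} \<Longrightarrow> tiling c col (F \<union> G)"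
  unfolding tiling_def by (auto intro: disjoint_union)

lemma tiling_subset: "tiling c col F \<Longrightarrow> G \<subseteq> F \<Longrightarrow> tiling c col G"
  unfolding tiling_def using pairwise_subset by blast

lemma finite_Union_tiling: "tiling c col F \<Longrightarrow> finite F \<Longrightarrow> finite (\<Union>F)"
  unfolding tiling_def using mono_triangle_finite by blast

lemma card_Union_Int_disjoint:
  assumes "finite F" "disjoint F" "\<And>T. T \<in> F \<Longrightarrow> finite (T \<inter> A) \<and> card (T \<inter> A) = k"
  shows "card (\<Union>F \<inter> A) = k * card F"
proof -
  have "\<Union>F \<inter> A = (\<Union>T\<in>F. T \<inter> A)" by blast
  moreover have "card (\<Union>T\<in>F. T \<inter> A) = (\<Sum>T\<in>F. card (T \<inter> A))"
    by (rule card_UN_disjoint) (use assms in \<open>auto simp: disjoint_def\<close>)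
  ultimately show ?thesis using assms by simp
qed

text \<open>Maximality gives structure: what the family leaves uncovered contains no further set
  with \<open>P\<close>. The empty set has to be excluded because, being disjoint from everything,
  it would violate the last conclusion.\<close>

lemma maximal_disjoint_family:
  assumes "finite V" "\<not> P {}"
  obtains F where "finite F" "disjoint F" "\<And>T. T \<in> F \<Longrightarrow> T \<subseteq> V \<and> P T"
    "\<And>T. T \<subseteq> V \<Longrightarrow> P T \<Longrightarrow> T \<inter> \<Union>F \<noteq> {}"
proof -
  define \<F> where "\<F> = {F. F \<subseteq> Pow V \<and> disjoint F \<and> (\<forall>T\<in>F. P T)}"
  have "finite \<F>" by (rule finite_subset[of _ "Pow (Pow V)"]) (auto simp: \<F>_def assms)
  moreover have "{} \<in> \<F>" by (auto simp: \<F>_def)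
  ultimately obtain F where F: "F \<in> \<F>" "\<And>G. G \<in> \<F> \<Longrightarrow> F \<subseteq> G \<Longrightarrow> F = G"
    using finite_has_maximal[of \<F>] by blast
  show ?thesis
  proof
    show "finite F" using F(1) assms(1) by (auto simp: \<F>_def intro: finite_subset)
    show "disjoint F" "\<And>T. T \<in> F \<Longrightarrow> T \<subseteq> V \<and> P T" using F(1) by (auto simp: \<F>_def)
    fix T assume T: "T \<subseteq> V" "P T"
    show "T \<inter> \<Union>F \<noteq> {}"
    proof
      assume e: "T \<inter> \<Union>F = {}"
      have "disjoint (insert T F)"
        by (rule disjoint_insert_set) (use F(1) e in \<open>auto simp: \<F>_def\<close>)
      then have "insert T F \<in> \<F>" using T F(1) by (auto simp: \<F>_def)
      then have "T \<in> F" using F(2) by blast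
      then show False using e assms(2) T(2) by (cases "T = {}") auto
    qed
  qed
qed

section \<open>Greedy covering by triangles inside infinite cliques\<close>

lemma coverable_insert:
  assumes "coverable c col S" "v \<in> Q" "infinite Q" "mono_clique c col Q"
  shows "coverable c col (insert v S)"
proof -
  obtain F where F: "finite F" "tiling c col F" "S \<subseteq> \<Union>F"
    using assms(1) unfolding coverable_def by blast
  show ?thesis
  proof (cases "v \<in> \<Union>F")
    case True
    then show ?thesis using F unfolding coverable_def by blast
  next
    case False
    \<comment> \<open>Only finitely many vertices are in use, so \<open>Q\<close> supplies two fresh
      partners for \<open>v\<close>.\<close>
    have fin: "finite (insert v (\<Union>F))" using finite_Union_tiling F by blast
    obtain a where a: "a \<in> Q - insert v (\<Union>F)"
      using infinite_imp_nonempty[OF Diff_infinite_finite[OF fin assms(3)]] by blast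
    have "finite (insert a (insert v (\<Union>F)))" using fin by simp
    then obtain b where b: "b \<in> Q - insert a (insert v (\<Union>F))"
      using infinite_imp_nonempty[OF Diff_infinite_finite[OF _ assms(3)]] by blast
    have "mono_triangle c col {v, a, b}"
      by (rule mono_triangle_insert3) (use a b assms in \<open>auto simp: mono_clique_def\<close>)
    then have "tiling c col (insert {v, a, b} F)"
      by (rule tiling_insert[OF F(2)]) (use a b False in auto)
    moreover have "insert v S \<subseteq> \<Union>(insert {v, a, b} F)" using F(3) by auto
    ultimately show ?thesis
      using F(1) unfolding coverable_def by (intro exI[of _ "insert {v, a, b} F"]) simp
  qed
qed

lemma coverable_Un:
  assumes "finite V" "coverable c col S"
    and "\<And>v. v \<in> V \<Longrightarrow> \<exists>Q. v \<in> Q \<and> infinite Q \<and> mono_clique c col Q"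
  shows "coverable c col (V \<union> S)"
  using assms
proof (induction V rule: finite_induct)
  case (insert v V)
  obtain Q where Q: "v \<in> Q" "infinite Q" "mono_clique c col Q" using insert.prems(2)[of v] by auto
  have "coverable c col (V \<union> S)" using insert.IH insert.prems by simp
  from coverable_insert[OF this Q] show ?case by simp
qed simp

lemma coverable_mono: "coverable c col S \<Longrightarrow> S' \<subseteq> S \<Longrightarrow> coverable c col S'"
  unfolding coverable_def by blast

lemma infinite_mono_clique:
  fixes c :: "'a set \<Rightarrow> colour"
  assumes "infinite Z"
  obtains Q col where "Q \<subseteq> Z" "infinite Q" "mono_clique c col Q"
proof -
  define f where "f e = (if c e = Red then 0 else (1::nat))" for e
  have f2: "\<forall>x\<in>Z. \<forall>y\<in>Z. x \<noteq> y \<longrightarrow> f {x, y} < 2" by (auto simp: f_def)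
  obtain Y s where Y: "Y \<subseteq> Z" "infinite Y" "\<forall>x\<in>Y. \<forall>y\<in>Y. x \<noteq> y \<longrightarrow> f {x, y} = s"
    using Ramsey2[OF assms, of f 2] f2 by blast
  have "mono_clique c (if s = 0 then Red else Blue) Y"
    unfolding mono_clique_def
  proof (intro ballI impI)
    fix x y assume "x \<in> Y" "y \<in> Y" "x \<noteq> y"
    then have "f {x, y} = s" using Y(3) by blast
    then show "c {x, y} = (if s = 0 then Red else Blue)"
      by (cases "c {x, y}") (auto simp: f_def)
  qed
  then show ?thesis using that Y by blast
qed

text \<open>Otherwise Ramsey's theorem, applied inside the set of exceptions, yields an infinite
  monochromatic clique of vertices that are in no such clique.\<close>

lemma finite_not_in_infinite_clique:
  fixes c :: "'a set \<Rightarrow> colour"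
  shows "finite {v. \<forall>col Q. v \<in> Q \<longrightarrow> infinite Q \<longrightarrow> \<not> mono_clique c col Q}" (is "finite ?C")
proof (rule ccontr)
  assume "infinite ?C"
  then obtain Q col where Q: "Q \<subseteq> ?C" "infinite Q" "mono_clique c col Q"
    by (rule infinite_mono_clique)
  obtain v where v: "v \<in> Q" using infinite_imp_nonempty[OF Q(2)] by auto
  have "v \<in> ?C" using Q(1) v by (rule subsetD)
  then show False using v Q(2,3) by auto
qed

section \<open>Competing tilings of two disjoint finite sets\<close>

text \<open>Here \<open>p\<close> counts triangles of colour \<open>b\<close> of type \<open>XYY\<close>, \<open>d\<close> the vertices of \<open>X\<close> left over by a
  maximal matching \<open>M\<close> of colour \<open>a\<close> and size \<open>m\<close> (they form a clique of colour \<open>b\<close>, which is tiled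
  up to two vertices), \<open>q\<close> the vertices of \<open>Y\<close> in triangles of colour \<open>a\<close> inside \<open>Y\<close>, and \<open>n\<close> the
  triangles of colour \<open>a\<close> consisting of an edge of \<open>M\<close> and a vertex of \<open>Y\<close>.\<close>

lemma bipartite_tilings:
  fixes X Y :: "'a set"
  assumes fin: "finite X" "finite Y" and disj: "X \<inter> Y = {}" and ne: "a \<noteq> b"
  obtains p d q n m FA FB where
    "finite FB" "tiling c b FB" "p + d \<le> card (\<Union>FB \<inter> X) + 2"
    "finite FA" "tiling c a FA" "q + n \<le> card (\<Union>FA \<inter> Y)"
    "p + d + 2 * m = card X"
    "n \<ge> m \<or> n + 2 * p + q + 4 \<ge> card Y"
proof -
  have col: "c e = a \<or> c e = b" for e
    using ne by (cases a; cases b; cases "c e") auto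
  define isP where "isP T \<longleftrightarrow> mono_triangle c b T \<and> card (T \<inter> X) = 1 \<and> card (T \<inter> Y) = 2" for T
  obtain P where P: "finite P" "disjoint P" "\<And>T. T \<in> P \<Longrightarrow> T \<subseteq> X \<union> Y \<and> isP T"
    "\<And>T. T \<subseteq> X \<union> Y \<Longrightarrow> isP T \<Longrightarrow> T \<inter> \<Union>P \<noteq> {}"
    by (rule maximal_disjoint_family[of "X \<union> Y" isP]) (use fin in \<open>auto simp: isP_def\<close>)
  have PX: "card (\<Union>P \<inter> X) = card P"
    using card_Union_Int_disjoint[OF P(1,2), of X 1] P(3) fin by (auto simp: isP_def)
  have PY: "card (\<Union>P \<inter> Y) = 2 * card P"
    using card_Union_Int_disjoint[OF P(1,2), of Y 2] P(3) fin by (auto simp: isP_def)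
  have tP: "tiling c b P" using P by (auto simp: tiling_def isP_def)
  define S where "S = X - \<Union>P"
  define T where "T = Y - \<Union>P"
  have cS: "card S + card P = card X"
    using card_Diff_subset_Int[of X "\<Union>P"] PX fin card_mono[of X "\<Union>P \<inter> X"]
    by (simp add: S_def Int_commute)
  have cT: "card T + 2 * card P = card Y"
    using card_Diff_subset_Int[of Y "\<Union>P"] PY fin card_mono[of Y "\<Union>P \<inter> Y"]
    by (simp add: T_def Int_commute)
  have finST: "finite S" "finite T" using fin by (auto simp: S_def T_def)

  obtain Q where Q: "finite Q" "disjoint Q" "\<And>U. U \<in> Q \<Longrightarrow> U \<subseteq> T \<and> mono_triangle c a U"
    "\<And>U. U \<subseteq> T \<Longrightarrow> mono_triangle c a U \<Longrightarrow> U \<inter> \<Union>Q \<noteq> {}"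
    by (rule maximal_disjoint_family[of T "mono_triangle c a"])
      (use finST in \<open>auto simp: mono_triangle_def\<close>)
  have tQ: "tiling c a Q" using Q by (auto simp: tiling_def)
  define T' where "T' = T - \<Union>Q"
  have QT: "\<Union>Q \<subseteq> T" using Q(3) by blast
  have cT': "card T' + card (\<Union>Q) = card T"
    using card_Diff_subset[OF finite_subset[OF QT finST(2)] QT] card_mono[OF finST(2) QT]
    by (simp add: T'_def)

  \<comment> \<open>Three \<open>b\<close>-neighbours would contain an \<open>a\<close>-triangle or a \<open>b\<close>-edge, against maximality of \<open>Q\<close> or \<open>P\<close>.\<close>
  have few: "card {y \<in> T'. c {x, y} = b} \<le> 2" if x: "x \<in> S" for x
  proof (rule ccontr)
    assume "\<not> ?thesis"
    then have "3 \<le> card {y \<in> T'. c {x, y} = b}" by simp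
    then obtain W where W: "W \<subseteq> {y \<in> T'. c {x, y} = b}" "card W = 3"
      by (rule obtain_subset_with_card_n) blast
    have WT: "W \<subseteq> T" using W by (auto simp: T'_def)
    have "\<not> mono_triangle c a W"
    proof
      assume "mono_triangle c a W"
      then have "W \<inter> \<Union>Q \<noteq> {}" using Q(4) WT by blast
      then show False using W(1) by (auto simp: T'_def)
    qed
    then obtain y z where yz: "y \<in> W" "z \<in> W" "y \<noteq> z" "c {y, z} = b"
      using W(2) col unfolding mono_triangle_def mono_clique_def by blast
    have xy: "x \<in> X" "y \<in> Y" "z \<in> Y" "x \<notin> Y" "y \<notin> X" "z \<notin> X" "x \<noteq> y" "x \<noteq> z"
      using x yz WT disj by (auto simp: S_def T_def)
    have "{x, y, z} \<inter> X = {x}" "{x, y, z} \<inter> Y = {y, z}" using xy by auto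
    moreover have "mono_triangle c b {x, y, z}"
      by (rule mono_triangle_insert3) (use xy yz W in auto)
    ultimately have "isP {x, y, z}" unfolding isP_def using yz by simp
    moreover have "{x, y, z} \<subseteq> X \<union> Y" using xy by auto
    ultimately have "{x, y, z} \<inter> \<Union>P \<noteq> {}" using P(4) by blast
    then show False using x yz WT by (auto simp: S_def T_def)
  qed

  obtain M where M: "finite M" "disjoint M"
    "\<And>e. e \<in> M \<Longrightarrow> e \<subseteq> S \<and> (card e = 2 \<and> c e = a)"
    "\<And>e. e \<subseteq> S \<Longrightarrow> card e = 2 \<and> c e = a \<Longrightarrow> e \<inter> \<Union>M \<noteq> {}"
    by (rule maximal_disjoint_family[of S "\<lambda>e. card e = 2 \<and> c e = a"]) (use finST in auto)
  have MS: "\<Union>M \<subseteq> S" using M(3) by blast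
  have cM: "card (\<Union>M) = 2 * card M"
  proof -
    have "card (\<Union>M \<inter> S) = 2 * card M"
    proof (rule card_Union_Int_disjoint[OF M(1,2)])
      fix e assume "e \<in> M"
      then have "e \<inter> S = e" "card e = 2" using M(3) by auto
      then show "finite (e \<inter> S) \<and> card (e \<inter> S) = 2" using finST(1) by (simp add: card_ge_0_finite)
    qed
    then show ?thesis using MS by (simp add: Int_absorb2)
  qed
  define D where "D = S - \<Union>M"
  have finD: "finite D" using finST by (auto simp: D_def)
  have cD: "card D + 2 * card M = card S"
    using card_Diff_subset[OF finite_subset[OF MS finST(1)] MS] card_mono[OF finST(1) MS] cM
    by (simp add: D_def)
  have Dcl: "mono_clique c b D"
    unfolding mono_clique_def
  proof (intro ballI impI)
    fix x y assume xy: "x \<in> D" "y \<in> D" "x \<noteq> y"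
    then have "{x, y} \<inter> \<Union>M = {}" "{x, y} \<subseteq> S" "card {x, y} = 2" by (auto simp: D_def)
    then have "c {x, y} \<noteq> a" using M(4) by blast
    then show "c {x, y} = b" using col by blast
  qed
  obtain E where E: "finite E" "disjoint E" "\<And>U. U \<in> E \<Longrightarrow> U \<subseteq> D \<and> mono_triangle c b U"
    "\<And>U. U \<subseteq> D \<Longrightarrow> mono_triangle c b U \<Longrightarrow> U \<inter> \<Union>E \<noteq> {}"
    by (rule maximal_disjoint_family[of D "mono_triangle c b"])
      (use finD in \<open>auto simp: mono_triangle_def\<close>)
  have tE: "tiling c b E" using E by (auto simp: tiling_def)
  have ED: "\<Union>E \<subseteq> D" using E(3) by blast
  have cE: "card D \<le> card (\<Union>E) + 2"
  proof (rule ccontr)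
    assume "\<not> ?thesis"
    then have "3 \<le> card (D - \<Union>E)"
      using card_Diff_subset[OF finite_subset[OF ED finD] ED] by simp
    then obtain W where W: "W \<subseteq> D - \<Union>E" "card W = 3" by (rule obtain_subset_with_card_n) blast
    then have "mono_triangle c b W" "W \<subseteq> D"
      using mono_clique_subset[OF Dcl] by (auto simp: mono_triangle_def)
    then show False using E(4) W by blast
  qed

  \<comment> \<open>Demanding \<open>U \<inter> S \<in> M\<close> makes each triangle of
    \<open>N\<close> use exactly one matching edge, so a matching edge used by no triangle is
    disjoint from all of \<open>\<Union>N\<close>.\<close>
  define isN where "isN U \<longleftrightarrow> mono_triangle c a U \<and> U \<inter> S \<in> M \<and> card (U \<inter> T') = 1" for U
  have finMT: "finite (\<Union>M \<union> T')"
    using finST finite_subset[OF MS] by (simp add: T'_def)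
  obtain N where N: "finite N" "disjoint N" "\<And>U. U \<in> N \<Longrightarrow> U \<subseteq> \<Union>M \<union> T' \<and> isN U"
    "\<And>U. U \<subseteq> \<Union>M \<union> T' \<Longrightarrow> isN U \<Longrightarrow> U \<inter> \<Union>N \<noteq> {}"
    by (rule maximal_disjoint_family[OF finMT, of isN]) (auto simp: isN_def)
  have tN: "tiling c a N" using N by (auto simp: tiling_def isN_def)
  have NT': "card (\<Union>N \<inter> T') = card N"
    using card_Union_Int_disjoint[OF N(1,2), of T' 1] N(3) finST by (auto simp: isN_def T'_def)
  have big: "card N \<ge> card M \<or> card N + 4 \<ge> card T'"
  proof (rule ccontr)
    assume neg: "\<not> ?thesis"
    have "card ((\<lambda>U. U \<inter> S) ` N) < card M"
      using card_image_le[OF N(1), of "\<lambda>U. U \<inter> S"] neg by linarith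
    moreover have sub: "(\<lambda>U. U \<inter> S) ` N \<subseteq> M" using N(3) by (auto simp: isN_def)
    ultimately have "(\<lambda>U. U \<inter> S) ` N \<subset> M" by (metis less_irrefl psubsetI)
    then obtain e where e: "e \<in> M" "e \<notin> (\<lambda>U. U \<inter> S) ` N"
      using psubset_imp_ex_mem by blast
    have eN: "e \<inter> \<Union>N = {}"
    proof (rule ccontr)
      assume "e \<inter> \<Union>N \<noteq> {}"
      then obtain z U where z: "z \<in> e" "z \<in> U" "U \<in> N" by blast
      then have US: "U \<inter> S \<in> M" "z \<in> U \<inter> S" using sub e(1) M(3) by auto
      have "U \<inter> S = e"
      proof (rule ccontr)
        assume "U \<inter> S \<noteq> e"
        then have "(U \<inter> S) \<inter> e = {}" by (rule disjointD[OF M(2) US(1) e(1)])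
        then show False using US(2) z(1) by blast
      qed
      then show False using e(2) z(3) by blast
    qed
    obtain x x' where xx: "e = {x, x'}" "x \<noteq> x'" using M(3)[OF e(1)] by (meson card_2_iff)
    have xS: "x \<in> S" "x' \<in> S" "c {x, x'} = a" using M(3)[OF e(1)] xx by auto
    define Z where "Z = (\<Union>N \<inter> T') \<union> ({y \<in> T'. c {x, y} = b} \<union> {y \<in> T'. c {x', y} = b})"
    have "card Z \<le> card N + (2 + 2)"
      unfolding Z_def using few[OF xS(1)] few[OF xS(2)] NT'
      card_Un_le[of "\<Union>N \<inter> T'" "{y \<in> T'. c {x, y} = b} \<union> {y \<in> T'. c {x', y} = b}"]
      card_Un_le[of "{y \<in> T'. c {x, y} = b}" "{y \<in> T'. c {x', y} = b}"]
      by linarith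
    then have "card Z < card T'" using neg by linarith
    moreover have "Z \<subseteq> T'" by (auto simp: Z_def)
    ultimately have "Z \<subset> T'" by (metis less_irrefl psubsetI)
    then obtain y where y: "y \<in> T'" "y \<notin> Z" using psubset_imp_ex_mem by blast
    have y1: "y \<in> Y" "y \<notin> S" "y \<noteq> x" "y \<noteq> x'" "y \<notin> \<Union>N" "c {x, y} = a" "c {x', y} = a"
      using y disj xS col[of "{x, y}"] col[of "{x', y}"]
      by (auto simp: Z_def T'_def T_def S_def)
    have xT: "x \<notin> T'" "x' \<notin> T'" using xS disj by (auto simp: S_def T'_def T_def)
    have "{x, x', y} \<inter> S = e" "{x, x', y} \<inter> T' = {y}" using xS y1 xx y xT by auto
    moreover have "mono_triangle c a {x, x', y}"
      by (rule mono_triangle_insert3) (use xx xS y1 in auto)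
    ultimately have "isN {x, x', y}" using e(1) by (simp add: isN_def)
    moreover have "{x, x', y} \<subseteq> \<Union>M \<union> T'" using e(1) xx y by auto
    ultimately have "{x, x', y} \<inter> \<Union>N \<noteq> {}" using N(4) by blast
    then show False using eN y1 xx by auto
  qed

  show ?thesis
  proof
    show "finite (P \<union> E)" using P(1) E(1) by simp
    show "tiling c b (P \<union> E)"
      by (rule tiling_Un[OF tP tE]) (use ED in \<open>auto simp: D_def S_def\<close>)
    have "\<Union>(P \<union> E) \<inter> X = (\<Union>P \<inter> X) \<union> \<Union>E" using ED by (auto simp: D_def S_def)
    moreover have "(\<Union>P \<inter> X) \<inter> \<Union>E = {}" using ED by (auto simp: D_def S_def)
    moreover have "finite (\<Union>E)" by (rule finite_subset[OF ED finD])
    ultimately have "card (\<Union>(P \<union> E) \<inter> X) = card P + card (\<Union>E)"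
      using fin PX by (simp add: card_Un_disjoint)
    then show "card P + card D \<le> card (\<Union>(P \<union> E) \<inter> X) + 2" using cE by simp
    show "finite (Q \<union> N)" using Q(1) N(1) by simp
    have NU: "\<Union>N \<subseteq> \<Union>M \<union> T'" using N(3) by blast
    have dQN: "\<Union>Q \<inter> \<Union>N = {}"
    proof -
      have "T \<subseteq> Y" "S \<subseteq> X" by (auto simp: T_def S_def)
      then have "\<Union>Q \<subseteq> Y" "\<Union>M \<subseteq> X" using QT MS by (auto simp only: subset_trans)
      then have "\<Union>Q \<inter> \<Union>M = {}" using disj by (simp only: disjoint_iff subset_iff) blast
      moreover have "\<Union>Q \<inter> T' = {}" by (auto simp: T'_def)
      ultimately have "\<Union>Q \<inter> (\<Union>M \<union> T') = {}" by (simp only: Int_Un_distrib Un_empty)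
      then show ?thesis using NU by (simp only: disjoint_iff subset_iff) blast
    qed
    show "tiling c a (Q \<union> N)" by (rule tiling_Un[OF tQ tN dQN])
    have "\<Union>Q \<union> (\<Union>N \<inter> T') \<subseteq> \<Union>(Q \<union> N) \<inter> Y" using QT by (auto simp: T'_def T_def)
    then have "card (\<Union>Q \<union> (\<Union>N \<inter> T')) \<le> card (\<Union>(Q \<union> N) \<inter> Y)"
      using fin by (intro card_mono) auto
    moreover have "card (\<Union>Q \<union> (\<Union>N \<inter> T')) = card (\<Union>Q) + card N"
    proof -
      have "finite (\<Union>Q)" "finite (\<Union>N \<inter> T')"
        using finite_subset[OF QT finST(2)] finST by (auto simp: T'_def)
      moreover have "\<Union>Q \<inter> (\<Union>N \<inter> T') = {}" using dQN by blast
      ultimately show ?thesis using NT' by (simp only: card_Un_disjoint)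
    qed
    ultimately show "card (\<Union>Q) + card N \<le> card (\<Union>(Q \<union> N) \<inter> Y)" by simp
    show "card P + card D + 2 * card M = card X" using cS cD by simp
    show "card N \<ge> card M \<or> card N + 2 * card P + card (\<Union>Q) + 4 \<ge> card Y"
      using big cT cT' by linarith
  qed
qed


section \<open>Density 5/8 in one colour at arbitrarily large scales\<close>

lemma tiling_counting_contradiction:
  fixes c :: "nat set \<Rightarrow> colour" and X Y C :: "nat set"
  assumes ne: "a \<noteq> b" and finC: "finite C" and disj: "X \<inter> Y = {}" and cover: "X \<union> Y \<union> C = UNIV"
    and Xcl: "\<And>v. v \<in> X \<Longrightarrow> \<exists>Q. v \<in> Q \<and> infinite Q \<and> mono_clique c a Q"
    and Ycl: "\<And>v. v \<in> Y \<Longrightarrow> \<exists>Q. v \<in> Q \<and> infinite Q \<and> mono_clique c b Q"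
    and bound: "\<And>t S col. T\<^sub>0 \<le> t \<Longrightarrow> S \<subseteq> {1..t} \<Longrightarrow> coverable c col S \<Longrightarrow> real (card S) < 5/8 * real t"
    and N: "2 * T\<^sub>0 + 2 \<le> N" "1000 * (card C + 5) \<le> N"
    and le: "card (Y \<inter> {1..N}) \<le> card (X \<inter> {1..N})"
  shows False
proof -
  \<comment> \<open>Lower-order terms aside, the bound for colour \<open>b\<close> on [t] gives m >
    3t/16. If n \<ge> m, colour \<open>a\<close> covers more than N/2 + 3t/16 vertices of [N], too
    many once t \<ge> 2N/3. Otherwise the bound for colour \<open>a\<close> on [N] gives p > 3N/16,
    while more than 3t/8 vertices of \<open>Y\<close> in [t] force p < t/4, impossible for t \<le>
    3N/4. The ratio 7/10 lies between 2/3 and 3/4.\<close>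
  define t where "t = 7 * N div 10"
  have t: "10 * t \<le> 7 * N" "7 * N < 10 * t + 10" by (auto simp: t_def)
  have tT: "T\<^sub>0 \<le> t" using t N by linarith
  have NT: "T\<^sub>0 \<le> N" using N by linarith
  have split: "n \<le> card (X \<inter> {1..n}) + card (Y \<inter> {1..n}) + card C" for n
  proof -
    have "{1..n} \<subseteq> (X \<inter> {1..n}) \<union> (Y \<inter> {1..n}) \<union> C" using cover by auto
    then have "card {1..n} \<le> card ((X \<inter> {1..n}) \<union> (Y \<inter> {1..n}) \<union> C)"
      using finC by (intro card_mono) auto
    also have "\<dots> \<le> card (X \<inter> {1..n}) + card (Y \<inter> {1..n}) + card C"
      using card_Un_le[of "(X \<inter> {1..n}) \<union> (Y \<inter> {1..n})" C]
        card_Un_le[of "X \<inter> {1..n}" "Y \<inter> {1..n}"] by linarith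
    finally show ?thesis by simp
  qed
  have disj': "(X \<inter> {1..t}) \<inter> (Y \<inter> {1..N}) = {}" using disj by blast
  obtain p d q n m FA FB where *:
    "finite FB" "tiling c b FB" "p + d \<le> card (\<Union>FB \<inter> (X \<inter> {1..t})) + 2"
    "finite FA" "tiling c a FA" "q + n \<le> card (\<Union>FA \<inter> (Y \<inter> {1..N}))"
    "p + d + 2 * m = card (X \<inter> {1..t})"
    "n \<ge> m \<or> n + 2 * p + q + 4 \<ge> card (Y \<inter> {1..N})"
    by (rule bipartite_tilings[OF _ _ disj' ne, of c]) auto
  have covB: "coverable c b (Y \<inter> {1..t} \<union> \<Union>FB)"
    by (rule coverable_Un) (use *(1,2) Ycl in \<open>auto simp: coverable_def\<close>)
  have covA: "coverable c a (X \<inter> {1..N} \<union> \<Union>FA)"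
    by (rule coverable_Un) (use *(4,5) Xcl in \<open>auto simp: coverable_def\<close>)
  \<comment> \<open>Covering \<open>X\<close> alone bounds its share of [t] by 5/8, so
    \<open>Y\<close> has nearly 3/8 of it.\<close>
  have covX: "coverable c a (X \<inter> {1..t} \<union> {})"
    by (rule coverable_Un) (use Xcl in \<open>auto simp: coverable_def tiling_def intro: exI[of _ "{}"]\<close>)
  have x: "real (card (X \<inter> {1..t})) < 5/8 * real t"
    using bound[OF tT _ covX] by simp
  \<comment> \<open>Triangles in \<open>FB\<close> may use vertices of \<open>Y\<close> beyond
    \<open>t\<close>; only their vertices in \<open>X\<close> are counted on top of
    \<open>Y \<inter> {1..t}\<close>.\<close>
  have "coverable c b (Y \<inter> {1..t} \<union> \<Union>FB \<inter> (X \<inter> {1..t}))"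
    by (rule coverable_mono[OF covB]) auto
  then have "real (card (Y \<inter> {1..t} \<union> \<Union>FB \<inter> (X \<inter> {1..t}))) < 5/8 * real t"
    by (intro bound[OF tT]) auto
  moreover have "card (Y \<inter> {1..t} \<union> \<Union>FB \<inter> (X \<inter> {1..t}))
      = card (Y \<inter> {1..t}) + card (\<Union>FB \<inter> (X \<inter> {1..t}))"
    by (rule card_Un_disjoint) (use disj in auto)
  ultimately have B: "real (card (Y \<inter> {1..t})) + real (card (\<Union>FB \<inter> (X \<inter> {1..t}))) < 5/8 * real t"
    by simp
  have "coverable c a (X \<inter> {1..N} \<union> \<Union>FA \<inter> (Y \<inter> {1..N}))"
    by (rule coverable_mono[OF covA]) auto
  then have "real (card (X \<inter> {1..N} \<union> \<Union>FA \<inter> (Y \<inter> {1..N}))) < 5/8 * real N"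
    by (intro bound[OF NT]) auto
  moreover have "card (X \<inter> {1..N} \<union> \<Union>FA \<inter> (Y \<inter> {1..N}))
      = card (X \<inter> {1..N}) + card (\<Union>FA \<inter> (Y \<inter> {1..N}))"
    by (rule card_Un_disjoint) (use disj in auto)
  ultimately have A: "real (card (X \<inter> {1..N})) + real (card (\<Union>FA \<inter> (Y \<inter> {1..N}))) < 5/8 * real N"
    by simp
  \<comment> \<open>Linear arithmetic over the reals remains; \<open>N(2)\<close> absorbs
    \<open>card C\<close>, the rounding of \<open>t\<close> and the additive constants.\<close>
  have real_le: "real i \<le> real j" if "i \<le> j" for i j :: nat using that by simp
  note r = real_le[OF split[of t]] real_le[OF split[of N]] real_le[OF *(3)] real_le[OF *(6)]
    real_le[OF N(2)] real_le[OF le] real_le[OF t(1)] real_le[OF less_imp_le[OF t(2)]]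
    arg_cong[OF *(7), of real]
  show False
    using *(8)
  proof
    assume "n \<ge> m"
    from r real_le[OF this] x A B show False by simp
  next
    assume "n + 2 * p + q + 4 \<ge> card (Y \<inter> {1..N})"
    from r real_le[OF this] x A B show False by simp
  qed
qed

text \<open>A single colour has to work at unboundedly many scales. If neither does, both colours
  are bounded from some common scale on, and one large \<open>N\<close> gives the
  contradiction.\<close>

lemma exists_dense_coverable:
  fixes c :: "nat set \<Rightarrow> colour"
  shows "\<exists>col. \<forall>T. \<exists>t\<ge>T. \<exists>S\<subseteq>{1..t}. coverable c col S \<and> 5/8 * real t \<le> real (card S)"
proof (rule ccontr)
  assume "\<not> ?thesis"
  then have "\<forall>col. \<exists>T. \<forall>t\<ge>T. \<forall>S\<subseteq>{1..t}. coverable c col S \<longrightarrow> real (card S) < 5/8 * real t"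
    by (meson not_le)
  then obtain T where T: "\<And>col t S. T col \<le> t \<Longrightarrow> S \<subseteq> {1..t} \<Longrightarrow> coverable c col S \<Longrightarrow>
      real (card S) < 5/8 * real t"
    by metis
  define T\<^sub>0 where "T\<^sub>0 = max (T Red) (T Blue)"
  have bound: "real (card S) < 5/8 * real t"
    if "T\<^sub>0 \<le> t" "S \<subseteq> {1..t}" "coverable c col S" for t S col
    by (rule T[OF _ that(2,3)]) (use that(1) in \<open>cases col; simp add: T\<^sub>0_def\<close>)
  define X where "X = {v. \<exists>Q. v \<in> Q \<and> infinite Q \<and> mono_clique c Red Q}"
  \<comment> \<open>Vertices in infinite cliques of both colours are put into \<open>X\<close> to
    make the classes disjoint.\<close>
  define Y where "Y = {v. \<exists>Q. v \<in> Q \<and> infinite Q \<and> mono_clique c Blue Q} - X"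
  define C where "C = {v. \<forall>col Q. v \<in> Q \<longrightarrow> infinite Q \<longrightarrow> \<not> mono_clique c col Q}"
  have finC: "finite C" unfolding C_def by (rule finite_not_in_infinite_clique)
  have cov: "X \<union> Y \<union> C = UNIV"
  proof -
    have "v \<in> X \<union> Y" if v: "v \<notin> C" for v
    proof -
      obtain col Q where Q: "v \<in> Q" "infinite Q" "mono_clique c col Q"
        using v unfolding C_def by auto
      then show ?thesis by (cases col) (auto simp: X_def Y_def)
    qed
    then show ?thesis by blast
  qed
  define N where "N = 2 * T\<^sub>0 + 2 + 1000 * (card C + 5)"
  have disj: "X \<inter> Y = {}" by (auto simp: Y_def)
  have Xcl: "\<exists>Q. v \<in> Q \<and> infinite Q \<and> mono_clique c Red Q" if "v \<in> X" for v
    using that by (simp add: X_def)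
  have Ycl: "\<exists>Q. v \<in> Q \<and> infinite Q \<and> mono_clique c Blue Q" if "v \<in> Y" for v
    using that by (simp add: Y_def)
  have N: "2 * T\<^sub>0 + 2 \<le> N" "1000 * (card C + 5) \<le> N" by (auto simp: N_def)
  show False
  proof (cases "card (Y \<inter> {1..N}) \<le> card (X \<inter> {1..N})")
    case True
    show False
      by (rule tiling_counting_contradiction[OF _ finC disj cov Xcl Ycl bound N True]) auto
  next
    \<comment> \<open>The situation is symmetric: exchange the two classes together with the
      colours.\<close>
    case False
    then have "card (X \<inter> {1..N}) \<le> card (Y \<inter> {1..N})" by simp
    moreover have "Y \<inter> X = {}" "Y \<union> X \<union> C = UNIV" using disj cov by auto
    ultimately show False
      by (intro tiling_counting_contradiction[OF _ finC _ _ Ycl Xcl bound N]) auto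
  qed
qed

section \<open>From finite tilings to infinite triangle factors\<close>

text \<open>Disjoint tiles meeting \<open>U\<close> pick distinct elements of \<open>U\<close>, so
  there are at most \<open>card U\<close> of them, with three vertices each.\<close>

lemma tiling_meeting_set_card:
  assumes "finite F" "tiling c col F" "finite U"
  shows "card (\<Union>{T \<in> F. T \<inter> U \<noteq> {}}) \<le> 3 * card U"
proof -
  define B where "B = {T \<in> F. T \<inter> U \<noteq> {}}"
  have B: "finite B" "\<And>T. T \<in> B \<Longrightarrow> card T = 3" "disjoint B"
    using assms tiling_subset[OF assms(2), of B]
    by (auto simp: B_def tiling_def mono_triangle_def)
  define pick where "pick T = (SOME x. x \<in> T \<inter> U)" for T
  have pick: "pick T \<in> T \<inter> U" if "T \<in> B" for T
    unfolding pick_def by (rule someI_ex) (use that in \<open>auto simp: B_def\<close>)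
  have "inj_on pick B"
  proof (rule inj_onI, rule ccontr)
    fix S T assume "S \<in> B" "T \<in> B" "pick S = pick T" "S \<noteq> T"
    then show False using pick[of S] pick[of T] disjointD[OF B(3), of S T] by auto
  qed
  then have "card B \<le> card U"
    by (rule card_inj_on_le) (use pick assms(3) in auto)
  moreover have "card (\<Union>B) \<le> (\<Sum>T\<in>B. card T)"
    by (rule card_Union_le_sum_card)
  moreover have "(\<Sum>T\<in>B. card T) = 3 * card B" using B(2) by simp
  ultimately show ?thesis unfolding B_def by linarith
qed

text \<open>A dense tiling at a much larger scale is added to \<open>G\<close> after dropping its
  tiles that meet \<open>G\<close>. This costs at most \<open>u\<close> vertices, a bound fixed
  before the new scale is chosen.\<close>

lemma extend_tiling:
  fixes c :: "nat set \<Rightarrow> colour"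
  assumes dense: "\<And>T. \<exists>t\<ge>T. \<exists>S\<subseteq>{1..t}. coverable c col S \<and> l * real t \<le> real (card S)"
    and l: "0 < l" and G: "finite G" "tiling c col G"
  shows "\<exists>t G'. n < t \<and> finite G' \<and> tiling c col G' \<and> G \<subset> G' \<and>
    (l - 1 / real (Suc n)) * real t \<le> real (card (\<Union>G' \<inter> {1..t}))"
proof -
  define u where "u = 3 * card (\<Union>G)"
  obtain K :: nat where K: "real u / l < real K" using reals_Archimedean2 by blast
  \<comment> \<open>The summands secure, in turn, n < t, a loss \<open>u\<close> of at most t/(n+1),
    and l t > u, so that a tile survives and the extension is proper.\<close>
  obtain t S where t: "Suc n + u * Suc n + K \<le> t"
    and S: "S \<subseteq> {1..t}" "coverable c col S" "l * real t \<le> real (card S)"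
    using dense by blast
  obtain F where F: "finite F" "tiling c col F" "S \<subseteq> \<Union>F" using S(2) unfolding coverable_def by auto
  define F' where "F' = {T \<in> F. T \<inter> \<Union>G = {}}"
  define R where "R = {T \<in> F. T \<inter> \<Union>G \<noteq> {}}"
  have finG: "finite (\<Union>G)" by (rule finite_Union_tiling[OF G(2,1)])
  have finR: "finite (\<Union>R)"
    by (rule finite_subset[OF _ finite_Union_tiling[OF F(2,1)]]) (auto simp: R_def)
  have R: "card (\<Union>R) \<le> u" unfolding R_def u_def by (rule tiling_meeting_set_card[OF F(1,2) finG])
  have "S \<subseteq> (\<Union>F' \<inter> {1..t}) \<union> \<Union>R" 
  proof
    fix s assume s: "s \<in> S"
    then obtain T where "T \<in> F" "s \<in> T" using F(3) by auto
    then show "s \<in> (\<Union>F' \<inter> {1..t}) \<union> \<Union>R"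
      using S(1) s by (cases "T \<inter> \<Union>G = {}") (auto simp: F'_def R_def)
  qed
  then have "card S \<le> card ((\<Union>F' \<inter> {1..t}) \<union> \<Union>R)" using finR by (intro card_mono) auto
  also have "\<dots> \<le> card (\<Union>F' \<inter> {1..t}) + u" using card_Un_le R by (meson add_left_mono order_trans)
  finally have cF': "l * real t - real u \<le> real (card (\<Union>F' \<inter> {1..t}))" using S(3) by linarith
  have "real u < l * real K" using K l by (simp add: field_simps)
  also have "\<dots> \<le> l * real t" using t l by simp
  finally have "0 < card (\<Union>F' \<inter> {1..t})" using cF' by linarith
  then have "\<Union>F' \<inter> {1..t} \<noteq> {}" by auto
  then obtain z T where z: "T \<in> F'" "z \<in> T" by auto
  have tF': "tiling c col F'" by (rule tiling_subset[OF F(2)]) (auto simp: F'_def)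
  have tG': "tiling c col (G \<union> F')"
    by (rule tiling_Un[OF G(2) tF']) (auto simp: F'_def)
  have "T \<notin> G" using z by (auto simp: F'_def)
  then have strict: "G \<subset> G \<union> F'" using z by blast
  have "real u * real (Suc n) \<le> real t"
    using t by (metis add_leE add_leD1 le_add2 of_nat_le_iff of_nat_mult order_trans)
  then have "real u \<le> 1 / real (Suc n) * real t" by (simp add: field_simps)
  moreover have "card (\<Union>F' \<inter> {1..t}) \<le> card (\<Union>(G \<union> F') \<inter> {1..t})" by (intro card_mono) auto
  ultimately have "(l - 1 / real (Suc n)) * real t \<le> real (card (\<Union>(G \<union> F') \<inter> {1..t}))"
    using cF' by (simp add: algebra_simps)
  moreover have "n < t" using t by simp
  moreover have "finite (G \<union> F')" using G(1) F(1) by (simp add: F'_def)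
  ultimately show ?thesis using tG' strict by blast
qed

text \<open>The union of an increasing chain of finite tilings keeps the density of its n-th member
  at that member's scale, and the errors 1/(n+1) tend to 0.\<close>

lemma infinite_dense_tiling:
  fixes c :: "nat set \<Rightarrow> colour"
  assumes dense: "\<And>T. \<exists>t\<ge>T. \<exists>S\<subseteq>{1..t}. coverable c col S \<and> l * real t \<le> real (card S)"
    and l: "0 < l"
  obtains G where "infinite G" "tiling c col G" "ereal l \<le> upper_density (\<Union>G)"
proof -
  define P where "P n p \<longleftrightarrow> n \<le> fst p \<and> 0 < fst p \<and> finite (snd p) \<and> tiling c col (snd p) \<and>
    (l - 1 / real n) * real (fst p) \<le> real (card (\<Union>(snd p) \<inter> {1..fst p}))"
    for n and p :: "nat \<times> nat set set"
  have step: "\<exists>p. P (Suc n) p \<and> G \<subset> snd p" if G: "finite G" "tiling c col G" for n G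
    using extend_tiling[OF dense l G, of n] unfolding P_def by (auto simp: Suc_le_eq)
  \<comment> \<open>The shift to \<open>Suc n\<close> avoids 1/0 = 0, which would demand density
    \<open>l\<close> without any error. Proper inclusion makes the union infinite.\<close>
  have "\<exists>f. \<forall>n. P (Suc n) (f n) \<and> snd (f n) \<subset> snd (f (Suc n))"
  proof (rule dependent_nat_choice)
    show "\<exists>p. P (Suc 0) p" using step[of "{}" 0] by (auto simp: tiling_def)
    fix p n assume "P (Suc n) p"
    then show "\<exists>q. P (Suc (Suc n)) q \<and> snd p \<subset> snd q" by (intro step) (auto simp: P_def)
  qed
  then obtain f where f: "\<And>n. P (Suc n) (f n)" "\<And>n. snd (f n) \<subset> snd (f (Suc n))" by blast
  define G where "G = (\<Union>n. snd (f n))"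
  have mono: "snd (f m) \<subseteq> snd (f n)" if "m \<le> n" for m n
    using lift_Suc_mono_le[of "\<lambda>n. snd (f n)", OF _ that] f(2) by auto
  have fin: "finite (snd (f n))" for n using f(1)[of n] by (simp add: P_def)
  have til: "tiling c col (snd (f n))" for n using f(1)[of n] by (simp add: P_def)
  show ?thesis
  proof
    have "n \<le> card (snd (f n))" for n
    proof (induction n)
      case (Suc n)
      then show ?case using psubset_card_mono[OF fin f(2), of n] by simp
    qed simp
    moreover have "card (snd (f n)) \<le> card G" if "finite G" for n
      by (rule card_mono[OF that]) (auto simp: G_def)
    ultimately show "infinite G" by (metis not_less_eq_eq order_trans)
    have "disjoint G"
    proof (rule disjointI)
      fix S T assume ST: "S \<in> G" "T \<in> G" "S \<noteq> T"
      then obtain m n where "S \<in> snd (f m)" "T \<in> snd (f n)" by (auto simp: G_def)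
      then have "S \<in> snd (f (max m n))" "T \<in> snd (f (max m n))"
        using mono[of m "max m n"] mono[of n "max m n"] by auto
      then show "S \<inter> T = {}" using til[of "max m n"] ST(3) by (auto simp: tiling_def dest: disjointD)
    qed
    then show "tiling c col G" using til by (auto simp: tiling_def G_def)
    show "ereal l \<le> upper_density (\<Union>G)"
    proof (rule ccontr)
      assume "\<not> ?thesis"
      then have "upper_density (\<Union>G) < ereal l" by simp
      then obtain y where y: "upper_density (\<Union>G) < ereal y" "ereal y < ereal l"
        using ereal_dense2 by blast
      from Limsup_lessD[OF y(1)[unfolded upper_density_def]]
      obtain n\<^sub>0 where n0: "\<And>t. n\<^sub>0 \<le> t \<Longrightarrow> real (card (\<Union>G \<inter> {1..t})) / real t < y"
        by (auto simp: eventually_sequentially)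
      obtain k where k: "1 / real (Suc k) < l - y"
        using y(2) reals_Archimedean[of "l - y"] by (auto simp: inverse_eq_divide)
      define n where "n = max n\<^sub>0 k"
      define t where "t = fst (f n)"
      have t: "Suc n \<le> t" "0 < t" "(l - 1 / real (Suc n)) * real t \<le> real (card (\<Union>(snd (f n)) \<inter> {1..t}))"
        using f(1)[of n] by (auto simp: P_def t_def)
      have "card (\<Union>(snd (f n)) \<inter> {1..t}) \<le> card (\<Union>G \<inter> {1..t})"
        by (intro card_mono) (auto simp: G_def)
      then have "(l - 1 / real (Suc n)) * real t \<le> real (card (\<Union>G \<inter> {1..t}))" using t(3) by linarith
      then have "l - 1 / real (Suc n) \<le> real (card (\<Union>G \<inter> {1..t})) / real t"
        using t(2) by (simp add: field_simps)
      also have "\<dots> < y" by (rule n0) (use t(1) in \<open>auto simp: n_def\<close>)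
      finally have "l - y < 1 / real (Suc n)" by simp
      moreover have "1 / real (Suc n) \<le> 1 / real (Suc k)" by (simp add: n_def frac_le)
      ultimately show False using k by linarith
    qed
  qed
qed

section \<open>An infinite tiling as a copy of \<omega>K3\<close>

lemma tiling_triangle_factor:
  fixes c :: "nat set \<Rightarrow> colour"
  assumes "infinite G" "tiling c col G"
  obtains H where "subgraph H K_nat" "Defs.monochromatic c H" "graph_iso (omega_copies K3) H"
    "verts H = \<Union>G"
proof -
  define H where "H = \<lparr>verts = \<Union>G, edges = {e. card e = 2 \<and> (\<exists>T\<in>G. e \<subseteq> T)}\<rparr>"
  have G3: "card T = 3" "mono_clique c col T" if "T \<in> G" for T
    using that assms(2) by (auto simp: tiling_def mono_triangle_def)
  have disj: "S = T" if "S \<in> G" "T \<in> G" "x \<in> S" "x \<in> T" for S T x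
    using that assms(2) disjointD[of G S T] by (auto simp: tiling_def)
  have "finite T" if "T \<in> G" for T using G3(1)[OF that] card_ge_0_finite by force
  then have "G \<subseteq> {A. finite A}" by auto
  then have "countable G"
    using countable_subset countable_Collect_finite by blast
  then have e: "bij_betw (from_nat_into G) UNIV G"
    using assms(1) by (rule bij_betw_from_nat_into)
  define e where "e = from_nat_into G"
  have eG: "e i \<in> G" for i using e by (auto simp: e_def bij_betw_def)
  have einj: "e i = e j \<longleftrightarrow> i = j" for i j using e by (auto simp: e_def bij_betw_def inj_on_def)
  have esurj: "\<exists>i. T = e i" if "T \<in> G" for T using e that by (auto simp: e_def bij_betw_def)
  have "\<exists>h. bij_betw h {0, 1, 2::nat} (e i)" for i
  proof (rule finite_same_card_bij)
    show "finite (e i)" by (rule card_ge_0_finite) (simp add: G3(1)[OF eG])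
    show "card {0, 1, 2::nat} = card (e i)" by (simp add: G3(1)[OF eG])
  qed simp
  then obtain h where h: "\<And>i. bij_betw (h i) {0, 1, 2::nat} (e i)" by metis
  define \<phi> where "\<phi> = (\<lambda>(i, j). h i j)"
  have \<phi>_mem: "\<phi> (i, j) \<in> e i" if "j \<in> {0, 1, 2}" for i j
    using h[of i] that by (auto simp: \<phi>_def bij_betw_def)
  \<comment> \<open>Tiles are disjoint, so a vertex determines the copy it comes from.\<close>
  have same: "i = i'" if "\<phi> (i, j) \<in> e i'" "j \<in> {0, 1, 2}" for i i' j
    using disj[OF eG eG \<phi>_mem[OF that(2)] that(1)] einj by blast
  have inj: "\<phi> (i, j) = \<phi> (i, j') \<longleftrightarrow> j = j'" if "j \<in> {0, 1, 2}" "j' \<in> {0, 1, 2}" for i j j'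
    using inj_on_eq_iff[OF bij_betw_imp_inj_on[OF h[of i]] that] by (simp add: \<phi>_def)
  have bij: "bij_betw \<phi> (UNIV \<times> {0, 1, 2}) (\<Union>G)"
    unfolding bij_betw_def
  proof
    show "inj_on \<phi> (UNIV \<times> {0, 1, 2})"
    proof (rule inj_onI, clarify)
      fix i j i' j' assume j: "j \<in> {0, 1, 2}" "j' \<in> {0, 1, 2}" and eq: "\<phi> (i, j) = \<phi> (i', j')"
      have "i = i'" using same[of i j i'] \<phi>_mem[OF j(2), of i'] eq j(1) by simp
      then show "i = i' \<and> j = j'" using inj[OF j] eq by simp
    qed
    show "\<phi> ` (UNIV \<times> {0, 1, 2}) = \<Union>G"
    proof
      show "\<phi> ` (UNIV \<times> {0, 1, 2}) \<subseteq> \<Union>G" using \<phi>_mem eG by fast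
      show "\<Union>G \<subseteq> \<phi> ` (UNIV \<times> {0, 1, 2})"
      proof
        fix x assume "x \<in> \<Union>G"
        then obtain i where "x \<in> e i" using esurj by auto
        then obtain j where "j \<in> {0, 1, 2}" "x = h i j" using h[of i] by (auto simp: bij_betw_def)
        then show "x \<in> \<phi> ` (UNIV \<times> {0, 1, 2})"
          by (intro image_eqI[of _ _ "(i, j)"]) (auto simp: \<phi>_def)
      qed
    qed
  qed
  \<comment> \<open>Equal vertices are included, since \<open>graph_iso\<close> also quantifies over
    them; singletons are edges on neither side.\<close>
  have edgeL: "{(i, j), (i', j')} \<in> edges (omega_copies K3) \<longleftrightarrow> i = i' \<and> j \<noteq> j'"
    if j: "j \<in> {0, 1, 2}" "j' \<in> {0, 1, 2}" for i j i' j'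
  proof
    assume "{(i, j), (i', j')} \<in> edges (omega_copies K3)"
    then obtain k s where s: "{(i, j), (i', j')} = Pair k ` s" "card s = 2"
      by (auto simp: omega_copies_def complete_graph_def)
    then have "card {(i, j), (i', j')} = 2" by (simp add: card_image inj_on_def)
    then have "(i, j) \<noteq> (i', j')" by auto
    moreover have "i = k" "i' = k" using s(1) by (auto simp: set_eq_iff)
    ultimately show "i = i' \<and> j \<noteq> j'" by auto
  next
    assume "i = i' \<and> j \<noteq> j'"
    then have "{(i, j), (i', j')} = Pair i ` {j, j'}" "card {j, j'} = 2" by auto
    moreover have "{j, j'} \<in> edges K3" using calculation(2) j by (simp add: complete_graph_def)
    ultimately show "{(i, j), (i', j')} \<in> edges (omega_copies K3)"
      unfolding omega_copies_def graph.simps by blast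
  qed
  have edgeR: "{\<phi> (i, j), \<phi> (i', j')} \<in> edges H \<longleftrightarrow> i = i' \<and> j \<noteq> j'"
    if j: "j \<in> {0, 1, 2}" "j' \<in> {0, 1, 2}" for i j i' j'
  proof
    assume "{\<phi> (i, j), \<phi> (i', j')} \<in> edges H"
    then obtain T where T: "T \<in> G" "\<phi> (i, j) \<in> T" "\<phi> (i', j') \<in> T"
        "card {\<phi> (i, j), \<phi> (i', j')} = 2"
      by (auto simp: H_def)
    obtain k where "T = e k" using esurj[OF T(1)] by blast
    then have "i = k" "i' = k" using same[OF _ j(1)] same[OF _ j(2)] T by auto
    then show "i = i' \<and> j \<noteq> j'" using T(4) by auto
  next
    assume "i = i' \<and> j \<noteq> j'"
    then have "\<phi> (i, j) \<noteq> \<phi> (i', j')" "\<phi> (i, j) \<in> e i" "\<phi> (i', j') \<in> e i"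
      using inj[OF j] \<phi>_mem j by auto
    then show "{\<phi> (i, j), \<phi> (i', j')} \<in> edges H" using eG[of i] by (auto simp: H_def)
  qed
  show ?thesis
  proof
    show "subgraph H K_nat"
      by (auto simp: subgraph_def simple_graph_def complete_graph_def H_def)
    show "Defs.monochromatic c H"
      unfolding Defs.monochromatic_def
    proof (intro exI[of _ col] ballI)
      fix s assume "s \<in> edges H"
      then obtain T x y where "T \<in> G" "s = {x, y}" "x \<noteq> y" "{x, y} \<subseteq> T"
        by (auto simp: H_def card_2_iff)
      then show "c s = col" using G3(2)[of T] by (auto simp: mono_clique_def)
    qed
    have V: "verts (omega_copies K3) = UNIV \<times> {0, 1, 2}" "verts H = \<Union>G"
      by (auto simp: omega_copies_def complete_graph_def H_def)
    show "verts H = \<Union>G" by (rule V(2))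
    show "graph_iso (omega_copies K3) H"
      unfolding graph_iso_def V
    proof (intro exI[of _ \<phi>] conjI ballI)
      fix u v :: "nat \<times> nat" assume "u \<in> UNIV \<times> {0, 1, 2}" "v \<in> UNIV \<times> {0, 1, 2}"
      moreover obtain i j i' j' where "u = (i, j)" "v = (i', j')" by fastforce
      ultimately show "{u, v} \<in> edges (omega_copies K3) \<longleftrightarrow> {\<phi> u, \<phi> v} \<in> edges H"
        using edgeL[of j j' i i'] edgeR[of j j' i i'] by simp
    qed (rule bij)
  qed
qed

lemma ramsey_density_triangles_ge: "ereal (5/8) \<le> ramsey_density (omega_copies K3)"
  unfolding ramsey_density_def
proof (rule Sup_upper, rule imageI, rule CollectI, rule allI)
  fix c :: "nat set \<Rightarrow> colour"
  obtain col where col: "\<And>T. \<exists>t\<ge>T. \<exists>S\<subseteq>{1..t}. coverable c col S \<and> 5/8 * real t \<le> real (card S)"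
    using exists_dense_coverable[of c] by blast
  obtain G where G: "infinite G" "tiling c col G" "ereal (5/8) \<le> upper_density (\<Union>G)"
    by (rule infinite_dense_tiling[OF col]) auto
  obtain H where H: "subgraph H K_nat" "Defs.monochromatic c H" "graph_iso (omega_copies K3) H"
    "verts H = \<Union>G"
    by (rule tiling_triangle_factor[OF G(1,2)])
  then show "\<exists>H'. subgraph H' K_nat \<and> Defs.monochromatic c H' \<and> graph_iso (omega_copies K3) H' \<and>
      ereal (5/8) \<le> upper_density (verts H')"
    using G(3) by auto
qed

section \<open>The function $f$\<close>

text \<open>By continuity the set of admissible points is closed, so its infimum is attained and is
  the value of \<open>LEAST\<close>.\<close>

lemma Gamma_plus_hitting:
  assumes g: "continuous_on {0..} g" and fin: "Gamma_plus \<gamma> g t \<noteq> \<infinity>"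
  obtains x where "Gamma_plus \<gamma> g t = ereal x" "0 \<le> x" "t \<le> \<gamma> * x + g x"
    "\<And>z. 0 \<le> z \<Longrightarrow> t \<le> \<gamma> * z + g z \<Longrightarrow> x \<le> z"
proof -
  define A where "A = {x \<in> {0..}. t \<le> \<gamma> * x + g x}"
  have ne: "A \<noteq> {}" using fin by (auto simp: Gamma_plus_def A_def split: if_splits)
  have "closed A" unfolding A_def
    by (rule continuous_on_closed_Collect_le) (auto intro!: continuous_intros g)
  moreover have bdd: "bdd_below A" by (auto simp: A_def intro: bdd_belowI[of _ 0])
  ultimately have mem: "Inf A \<in> A" using ne closed_contains_Inf by blast
  have low: "Inf A \<le> z" if "0 \<le> z" "t \<le> \<gamma> * z + g z" for z
    by (rule cInf_lower[OF _ bdd]) (use that in \<open>simp add: A_def\<close>)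
  have "(LEAST x. 0 \<le> x \<and> t \<le> \<gamma> * x + g x) = Inf A"
    by (rule Least_equality) (use mem low in \<open>auto simp: A_def\<close>)
  then have "Gamma_plus \<gamma> g t = ereal (Inf A)"
    using fin by (auto simp: Gamma_plus_def split: if_splits)
  then show ?thesis using that[of "Inf A"] mem low by (auto simp: A_def)
qed

lemma Gamma_minus_eq: "Gamma_minus \<gamma> g t = Gamma_plus \<gamma> (\<lambda>x. - g x) t"
  by (simp add: Gamma_minus_def Gamma_plus_def)

lemma hitting_times_contradiction:
  fixes g x y :: "real \<Rightarrow> real"
  assumes lip: "1-lipschitz_on {0..} g" "g 0 = 0"
    and x: "\<And>t. T \<le> t \<Longrightarrow> 0 \<le> x t \<and> t \<le> x t / 3 + g (x t)"
    and y: "\<And>t. T \<le> t \<Longrightarrow> 0 \<le> y t \<and> t \<le> y t / 3 - g (y t)"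
    and ymin: "\<And>t z. T \<le> t \<Longrightarrow> 0 \<le> z \<Longrightarrow> t \<le> z / 3 - g z \<Longrightarrow> y t \<le> z"
    and sum: "\<And>t. T \<le> t \<Longrightarrow> x t + y t < 3 * t"
    and T: "0 < T" and le: "x T \<le> y T"
  shows False
proof -
  have L: "\<bar>g u - g v\<bar> \<le> \<bar>u - v\<bar>" if "0 \<le> u" "0 \<le> v" for u v
    using lipschitz_onD[OF lip(1), of u v] that by (simp add: dist_real_def)
  \<comment> \<open>From g 0 = 0, the function is at most z in absolute value at z, so t \<le> 4z/3
    at either hitting time z.\<close>
  have low: "3/4 * t \<le> x t" "3/4 * t \<le> y t" if "T \<le> t" for t
    using x[OF that] y[OF that] L[of "x t" 0] L[of "y t" 0] lip(2) by auto
  define u where "u = y T"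
  \<comment> \<open>Adding both hitting inequalities at \<open>T\<close> gives 2T \<le> (x+y)/3 +
    (y-x), and x \<ge> 3T/4.\<close>
  have "15/8 * T \<le> u"
    using x[of T] y[of T] L[of "x T" "y T"] low[of T] le by (auto simp: u_def)
  then have uT: "T \<le> u" using T by simp
  have "u \<le> y u"
    using ymin[of T "y u"] y[OF uT] uT by (simp add: u_def)
  have xu: "x u < u"
  \<comment> \<open>Otherwise both times at \<open>u\<close> are at least \<open>u\<close> with sum
    below 3u, so they differ by less than \<open>u\<close>; yet adding the hitting inequalities
    gives 2u < u + |x-y|.\<close>
  proof (rule ccontr)
    assume "\<not> x u < u"
    show False
      using x[OF uT] y[OF uT] L[of "x u" "y u"] low[OF uT] sum[OF uT] \<open>u \<le> y u\<close> \<open>\<not> x u < u\<close> T uT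
      by auto
  qed
  have "T \<le> u / 3 - g u" using y[of T] by (simp add: u_def)
  \<comment> \<open>Comparing \<open>g\<close> at \<open>x u\<close> and at \<open>u\<close> yields
    x u < u/2, against x u \<ge> 3u/4.\<close>
  then show False
    using x[OF uT] L[of "x u" u] low(1)[OF uT] xu T uT by auto
qed

lemma h_inf_third_ge: "3 \<le> h_inf (1/3)"
  unfolding h_inf_def
proof (rule INF_greatest, rule ccontr)
  fix g :: "real \<Rightarrow> real"
  assume "g \<in> {g. 1-lipschitz_on {0..} g \<and> g 0 = 0}"
  then have g: "1-lipschitz_on {0..} g" "g 0 = 0" by auto
  assume "\<not> 3 \<le> Limsup at_top (\<lambda>t. (Gamma_plus (1/3) g t + Gamma_minus (1/3) g t) / ereal t)"
  then have "Limsup at_top (\<lambda>t. (Gamma_plus (1/3) g t + Gamma_minus (1/3) g t) / ereal t) < 3"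
    by simp
  from Limsup_lessD[OF this] obtain T\<^sub>0 where T0:
    "\<And>t. T\<^sub>0 \<le> t \<Longrightarrow> (Gamma_plus (1/3) g t + Gamma_minus (1/3) g t) / ereal t < 3"
    unfolding eventually_at_top_linorder by blast
  define T where "T = max T\<^sub>0 1"
  have cont: "continuous_on {0..} g" "continuous_on {0..} (\<lambda>x. - g x)"
    using lipschitz_on_continuous_on[OF g(1)] by (auto intro: continuous_intros)
  have nonneg: "0 \<le> Gamma_plus (1/3) g t" if "continuous_on {0..} g" for g t
  proof (cases "Gamma_plus (1/3) g t = \<infinity>")
    case False
    from Gamma_plus_hitting[OF that False] show ?thesis by (metis ereal_less_eq(5))
  qed simp
  \<comment> \<open>An infinite hitting time would make the quotient infinite rather than below
    3.\<close>
  have fin: "Gamma_plus (1/3) g t \<noteq> \<infinity> \<and> Gamma_plus (1/3) (\<lambda>x. - g x) t \<noteq> \<infinity>" if "T \<le> t" for t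
    using T0[of t] that nonneg[OF cont(1), of t] nonneg[OF cont(2), of t]
    by (auto simp: T_def Gamma_minus_eq)
  have "\<exists>x. \<forall>t\<ge>T. Gamma_plus (1/3) g t = ereal (x t) \<and> 0 \<le> x t \<and> t \<le> x t / 3 + g (x t) \<and>
     (\<forall>z\<ge>0. t \<le> z / 3 + g z \<longrightarrow> x t \<le> z)"
    if "continuous_on {0..} g" "\<And>t. T \<le> t \<Longrightarrow> Gamma_plus (1/3) g t \<noteq> \<infinity>" for g
  proof -
    have "\<exists>x. Gamma_plus (1/3) g t = ereal x \<and> 0 \<le> x \<and> t \<le> x / 3 + g x \<and>
       (\<forall>z\<ge>0. t \<le> z / 3 + g z \<longrightarrow> x \<le> z)" if "T \<le> t" for t
      by (rule Gamma_plus_hitting[OF \<open>continuous_on {0..} g\<close> \<open>\<And>t. T \<le> t \<Longrightarrow> Gamma_plus (1/3) g t \<noteq> \<infinity>\<close>[OF that]]) auto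
    then show ?thesis by metis
  qed
  note hit = this
  obtain x where x: "\<And>t. T \<le> t \<Longrightarrow> Gamma_plus (1/3) g t = ereal (x t) \<and> 0 \<le> x t \<and> t \<le> x t / 3 + g (x t) \<and>
     (\<forall>z\<ge>0. t \<le> z / 3 + g z \<longrightarrow> x t \<le> z)"
    using hit[OF cont(1)] fin by blast
  obtain y where y: "\<And>t. T \<le> t \<Longrightarrow> Gamma_plus (1/3) (\<lambda>x. - g x) t = ereal (y t) \<and> 0 \<le> y t \<and>
     t \<le> y t / 3 - g (y t) \<and> (\<forall>z\<ge>0. t \<le> z / 3 - g z \<longrightarrow> y t \<le> z)"
    using hit[OF cont(2)] fin by auto
  have sum: "x t + y t < 3 * t" if "T \<le> t" for t
  proof -
    have "0 < t" using that by (simp add: T_def)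
    moreover have "ereal ((x t + y t) / t) < ereal 3"
      using T0[of t] that x[OF that] y[OF that] by (simp add: T_def Gamma_minus_eq)
    ultimately show ?thesis by (simp add: field_simps)
  qed
  have "0 < T" by (simp add: T_def)
  have lip': "1-lipschitz_on {0..} (\<lambda>x. - g x)" using g(1) by (simp add: lipschitz_on_minus)
  show False
  proof (cases "x T \<le> y T")
    case True
    show False
      by (rule hitting_times_contradiction[OF g, of T x y]) (use x y sum \<open>0 < T\<close> True in auto)
  next
    \<comment> \<open>Passing to -g exchanges the two hitting times.\<close>
    case False
    show False
      by (rule hitting_times_contradiction[OF lip', of T y x])
        (use x y sum \<open>0 < T\<close> False g in \<open>auto simp: add.commute\<close>)
  qed
qed

lemma f_dens_2_ge: "ereal (5/8) \<le> f_dens 2"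
proof -
  \<comment> \<open>For l = 2 the argument of \<open>h_inf\<close> is 1/3 and the coefficients are
    4/9 and 4/3; h \<ge> 3 gives a denominator of at least 8/3.\<close>
  define D where "D = ereal (4/9) * h_inf (1/3) + ereal (4/3)"
  have "ereal (4/9) * ereal 3 \<le> ereal (4/9) * h_inf (1/3)"
    using h_inf_third_ge by (intro ereal_mult_left_mono) auto
  then have "ereal (4/9) * ereal 3 + ereal (4/3) \<le> D" unfolding D_def by (rule add_right_mono)
  then have D: "ereal (8/3) \<le> D" by simp
  have "1 / D \<le> ereal (3/8)"
  proof (cases D)
    case (real d)
    then have "8/3 \<le> d" using D by simp
    then show ?thesis using real by (simp add: one_ereal_def field_simps)
  qed (use D in auto)
  then have "1 - ereal (3/8) \<le> 1 - 1 / D" by (intro ereal_minus_mono) auto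
  moreover have "f_dens 2 = 1 - 1 / D" by (simp add: f_dens_def D_def power2_eq_square)
  ultimately show ?thesis by (simp add: one_ereal_def)
qed

theorem theorem3:
  "ramsey_density (omega_copies K3) \<ge> ereal (1 - 1 / sqrt 7) \<and>
   f_dens 2 \<ge> ereal (1 - 1 / sqrt 7)"
proof -
  \<comment> \<open>This is 63 \<le> 64, so 5/8 just exceeds the claimed bound.\<close>
  have "sqrt 7 \<le> 8/3" by (rule real_le_lsqrt) (auto simp: power2_eq_square)
  then have "3/8 \<le> 1 / sqrt 7" by (simp add: field_simps)
  then have "ereal (1 - 1 / sqrt 7) \<le> ereal (5/8)" by simp
  then show ?thesis using ramsey_density_triangles_ge f_dens_2_ge order_trans by blast
qed

end
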